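(* Let $G$ and $H$ be connected graphs, each having at least two vertices. Then $\chi_{lid}(G \square H) \leq \chi(G)\,\chi(H)$.
   Context: $\chi(G)$ is the chromatic number of $G$. A proper $k$-coloring of a graph $G$ is a map $f:V(G)\to\{1,\dots,k\}$ with $f(u)\neq f(v)$ for every edge $uv$. For a vertex $v$, $N[v]$ denotes its closed neighborhood, and $f(S)=\{f(x):x\in S\}$. A lid-coloring of $G$ is a proper coloring $f$ such that for every edge $uv$ with $N[u]\neq N[v]$ we have $f(N[u])\neq f(N[v])$; $\chi_{lid}(G)$ is the smallest number of colors in a lid-coloring of $G$. The Cartesian product $G\square H$ has vertex set $V(G)\times V(H)$, where $(u_1,v_1)$ and $(u_2,v_2)$ are adjacent iff either $u_1=u_2$ and $v_1v_2\in E(H)$, or $v_1=v_2$ and $u_1u_2\in E(G)$. *)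

theory Defs
  imports "Graph_Theory.Graph_Theory" "HOL-Library.Extended_Nat"
begin

text \<open>
  A simple graph is a loop-free symmetric digraph without parallel arcs
  (\<^locale>\<open>pair_bidirected_digraph\<close>); an edge \<open>uv\<close> is the pair of arcs \<open>(u, v)\<close>, \<open>(v, u)\<close>.
  Finiteness is not required: the chromatic parameters below take values in \<^typ>\<open>enat\<close>, being
  \<open>\<infinity>\<close> when no finite number of colors suffices.  On finite graphs they are finite
  and are attained minima, as shown below.
\<close>

definition closed_nbhd :: "'a pair_pre_digraph \<Rightarrow> 'a \<Rightarrow> 'a set" where
  "closed_nbhd G v = insert v {u. (v, u) \<in> parcs G}"

definition proper_coloring :: "'a pair_pre_digraph \<Rightarrow> nat \<Rightarrow> ('a \<Rightarrow> nat) \<Rightarrow> bool" where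
  "proper_coloring G k f \<longleftrightarrow>
     f ` pverts G \<subseteq> {1..k} \<and> (\<forall>(u, v) \<in> parcs G. f u \<noteq> f v)"

definition lid_coloring :: "'a pair_pre_digraph \<Rightarrow> nat \<Rightarrow> ('a \<Rightarrow> nat) \<Rightarrow> bool" where
  "lid_coloring G k f \<longleftrightarrow>
     proper_coloring G k f \<and>
     (\<forall>(u, v) \<in> parcs G. closed_nbhd G u \<noteq> closed_nbhd G v
        \<longrightarrow> f ` closed_nbhd G u \<noteq> f ` closed_nbhd G v)"

definition chromatic_number :: "'a pair_pre_digraph \<Rightarrow> enat" where
  "chromatic_number G = Inf {enat k |k. \<exists>f. proper_coloring G k f}"

definition lid_chromatic_number :: "'a pair_pre_digraph \<Rightarrow> enat" where
  "lid_chromatic_number G = Inf {enat k |k. \<exists>f. lid_coloring G k f}"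

definition cartesian_product ::
  "'a pair_pre_digraph \<Rightarrow> 'b pair_pre_digraph \<Rightarrow> ('a \<times> 'b) pair_pre_digraph" where
  "cartesian_product G H =
     \<lparr> pverts = pverts G \<times> pverts H,
       parcs = {((u1, v1), (u2, v2)) |u1 v1 u2 v2.
         u1 = u2 \<and> u1 \<in> pverts G \<and> (v1, v2) \<in> parcs H \<or>
         v1 = v2 \<and> v1 \<in> pverts H \<and> (u1, u2) \<in> parcs G} \<rparr>"

lemma pair_bidirected_digraph_cartesian_product:
  assumes "pair_bidirected_digraph G" and "pair_bidirected_digraph H"
  shows "pair_bidirected_digraph (cartesian_product G H)"
proof -
  interpret G: pair_bidirected_digraph G by fact
  interpret H: pair_bidirected_digraph H by fact
  have "sym (parcs G)" "sym (parcs H)"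
    using G.pair_sym_arcs H.pair_sym_arcs by (simp_all add: symmetric_def)
  then show ?thesis
    by unfold_locales
      (auto simp: cartesian_product_def symmetric_def intro!: symI
        dest: G.in_arcsD1 G.in_arcsD2 H.in_arcsD1 H.in_arcsD2
          G.pair_no_loops H.pair_no_loops symD)
qed

lemma ex_lid_coloring_finite:
  assumes "pair_graph G"
  shows "\<exists>k f. lid_coloring G k f"
proof -
  interpret G: pair_graph G by fact
  obtain h :: "'a \<Rightarrow> nat" where h: "inj_on h (pverts G)"
    using finite_imp_inj_to_nat_seg[OF G.pair_finite_verts] by blast
  define k where "k = Suc (Max (h ` pverts G))"
  have *: "h v \<le> Max (h ` pverts G)" if "v \<in> pverts G" for v
    using that G.pair_finite_verts by simp
  have inj: "inj_on (\<lambda>v. Suc (h v)) (pverts G)"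
    using h by (auto simp: inj_on_def)
  have "proper_coloring G k (\<lambda>v. Suc (h v))"
    unfolding proper_coloring_def k_def using * h
    by (fastforce simp: inj_on_def dest: G.in_arcsD1 G.in_arcsD2 G.pair_no_loops)
  moreover have "closed_nbhd G v \<subseteq> pverts G" if "v \<in> pverts G" for v
    using that by (auto simp: closed_nbhd_def dest: G.in_arcsD2)
  ultimately have "lid_coloring G k (\<lambda>v. Suc (h v))"
    unfolding lid_coloring_def using inj_on_image_eq_iff[OF inj]
    by (metis (mono_tags, lifting) G.in_arcsD1 G.in_arcsD2 case_prodI2)
  then show ?thesis by blast
qed

lemma Inf_enat_eq_Least:
  assumes "\<exists>k. P k"
  shows "Inf {enat k |k. P k} = enat (LEAST k. P k)"
proof (rule antisym)
  show "Inf {enat k |k. P k} \<le> enat (LEAST k. P k)"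
    using LeastI_ex[OF assms] by (auto intro: Inf_lower)
  show "enat (LEAST k. P k) \<le> Inf {enat k |k. P k}"
    by (auto intro!: Inf_greatest Least_le)
qed

lemma chromatic_number_finite:
  assumes "pair_graph G"
  shows "chromatic_number G = enat (LEAST k. \<exists>f. proper_coloring G k f)"
  unfolding chromatic_number_def using ex_lid_coloring_finite[OF assms]
  by (intro Inf_enat_eq_Least) (auto simp: lid_coloring_def)

lemma lid_chromatic_number_finite:
  assumes "pair_graph G"
  shows "lid_chromatic_number G = enat (LEAST k. \<exists>f. lid_coloring G k f)"
  unfolding lid_chromatic_number_def using ex_lid_coloring_finite[OF assms]
  by (intro Inf_enat_eq_Least)

end

theory Submission
  imports Defs
begin

text \<open>
  Color \<open>G \<box> H\<close> by the pairs \<open>(c u, d v)\<close>, where \<open>c\<close> and \<open>d\<close> are any proper colorings of \<open>G\<close> and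
  \<open>H\<close>.  Along an edge \<open>(u, v)(u', v)\<close> pick a neighbor \<open>y\<close> of \<open>v\<close>: the color \<open>(c u, d y)\<close> is seen
  by \<open>(u, v)\<close>, but everything seen by \<open>(u', v)\<close> has first component \<open>c u' \<noteq> c u\<close> or second
  component \<open>d v \<noteq> d y\<close>.  Connectedness only serves to exclude isolated vertices.
\<close>

text \<open>Symmetric arcs upgrade connectedness to directed reachability, and a directed walk from
  \<open>v\<close> to a different vertex must begin with an arc leaving \<open>v\<close>.\<close>

lemma connected_ex_neighbor:
  assumes "pair_bidirected_digraph G"
    and "Digraph_Component.connected (with_proj G)"
    and "\<exists>u\<in>pverts G. \<exists>v\<in>pverts G. u \<noteq> v"
    and "v \<in> pverts G"
  shows "\<exists>w. (v, w) \<in> parcs G"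
proof -
  interpret G: pair_bidirected_digraph G by fact
  obtain x where x: "x \<in> pverts G" "x \<noteq> v"
    using assms(3) by blast
  have "strongly_connected (with_proj G)"
    using G.symmetric_connected_imp_strongly_connected[OF G.sym_arcs assms(2)] .
  then have "v \<rightarrow>\<^sup>*\<^bsub>with_proj G\<^esub> x"
    using assms(4) x(1) by auto
  then show ?thesis
    using x(2) by (cases rule: G.converse_reachable_cases) auto
qed

lemma product_color_separates:
  assumes c: "\<forall>(x, x')\<in>parcs G. c x \<noteq> c x'" and d: "\<forall>(y, y')\<in>parcs H. d y \<noteq> d y'"
    and u: "u \<in> pverts G" and uu': "(u, u') \<in> parcs G" and vy: "(v, y) \<in> parcs H"
  shows "map_prod c d ` closed_nbhd (cartesian_product G H) (u, v)
           \<noteq> map_prod c d ` closed_nbhd (cartesian_product G H) (u', v)"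
proof -
  have "(c u, d y) \<in> map_prod c d ` closed_nbhd (cartesian_product G H) (u, v)"
    using u vy by (intro image_eqI[of _ _ "(u, y)"])
      (auto simp: closed_nbhd_def cartesian_product_def)
  moreover have "(c u, d y) \<notin> map_prod c d ` closed_nbhd (cartesian_product G H) (u', v)"
    using c d uu' vy by (fastforce simp: closed_nbhd_def cartesian_product_def)
  ultimately show ?thesis by metis
qed

text \<open>Mirror image for edges in the direction of \<open>H\<close>: the separating color now
  comes from a neighbor \<open>x\<close> of \<open>u\<close> in \<open>G\<close>.\<close>

lemma product_color_separates':
  assumes c: "\<forall>(x, x')\<in>parcs G. c x \<noteq> c x'" and d: "\<forall>(y, y')\<in>parcs H. d y \<noteq> d y'"
    and v: "v \<in> pverts H" and vv': "(v, v') \<in> parcs H" and ux: "(u, x) \<in> parcs G"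
  shows "map_prod c d ` closed_nbhd (cartesian_product G H) (u, v)
           \<noteq> map_prod c d ` closed_nbhd (cartesian_product G H) (u, v')"
proof -
  have "(c x, d v) \<in> map_prod c d ` closed_nbhd (cartesian_product G H) (u, v)"
    using v ux by (intro image_eqI[of _ _ "(x, v)"])
      (auto simp: closed_nbhd_def cartesian_product_def)
  moreover have "(c x, d v) \<notin> map_prod c d ` closed_nbhd (cartesian_product G H) (u, v')"
    using c d vv' ux by (fastforce simp: closed_nbhd_def cartesian_product_def)
  ultimately show ?thesis by metis
qed

lemma ex_lid_coloring_cartesian_product:
  assumes G: "pair_bidirected_digraph G" and H: "pair_bidirected_digraph H"
    and nbG: "\<And>u. u \<in> pverts G \<Longrightarrow> \<exists>x. (u, x) \<in> parcs G"
    and nbH: "\<And>v. v \<in> pverts H \<Longrightarrow> \<exists>y. (v, y) \<in> parcs H"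
    and c: "proper_coloring G k c" and d: "proper_coloring H l d"
  shows "\<exists>f. lid_coloring (cartesian_product G H) (k * l) f"
proof -
  let ?P = "cartesian_product G H"
  interpret G: pair_bidirected_digraph G by fact
  interpret H: pair_bidirected_digraph H by fact
  interpret P: pair_bidirected_digraph ?P
    using G H by (rule pair_bidirected_digraph_cartesian_product)
  have c': "\<forall>(x, x')\<in>parcs G. c x \<noteq> c x'" and d': "\<forall>(y, y')\<in>parcs H. d y \<noteq> d y'"
    using c d by (simp_all add: proper_coloring_def)
  let ?C = "{1..k} \<times> {1..l}"
  \<comment> \<open>Colors are natural numbers, so the pairs are renumbered; \<open>b\<close> exists
    because both sets have \<open>k * l\<close> elements.\<close>
  obtain b where b: "bij_betw b ?C {1..k * l}"
    using finite_same_card_bij[of ?C "{1..k * l}"] by auto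
  have inj: "inj_on b ?C" and img: "b ` ?C = {1..k * l}"
    using b by (auto simp: bij_betw_def)
  have col: "map_prod c d p \<in> ?C" if "p \<in> pverts ?P" for p
    using that c d by (auto simp: proper_coloring_def cartesian_product_def image_subset_iff
        simp del: atLeastAtMost_iff)
  \<comment> \<open>\<open>b\<close> is injective only on \<open>?C\<close>, so cancelling it from
    an equation of color sets requires both sets to lie there.\<close>
  have nbhd: "map_prod c d ` closed_nbhd ?P p \<subseteq> ?C" if "p \<in> pverts ?P" for p
  proof -
    have "closed_nbhd ?P p \<subseteq> pverts ?P"
      using that P.in_arcsD2 unfolding closed_nbhd_def by blast
    then show ?thesis using col by (metis image_subsetI subsetD)
  qed
  have sep: "map_prod c d ` closed_nbhd ?P p \<noteq> map_prod c d ` closed_nbhd ?P q"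
    if pq: "(p, q) \<in> parcs ?P" for p q
  proof -
    from pq consider
        u v v' where "p = (u, v)" "q = (u, v')" "u \<in> pverts G" "(v, v') \<in> parcs H"
      | u u' v where "p = (u, v)" "q = (u', v)" "v \<in> pverts H" "(u, u') \<in> parcs G"
      unfolding cartesian_product_def by auto
    then show ?thesis
    proof cases
      case 1
      \<comment> \<open>The edge moves in \<open>H\<close>, so the auxiliary neighbor is taken in
        \<open>G\<close>; the other case is the reverse.\<close>
      then show ?thesis
        using nbG product_color_separates'[OF c' d'] H.in_arcsD1 by metis
    next
      case 2
      then show ?thesis
        using nbH product_color_separates[OF c' d'] G.in_arcsD1 by metis
    qed
  qed
  have "lid_coloring ?P (k * l) (b \<circ> map_prod c d)"
    unfolding lid_coloring_def
  proof (intro conjI)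
    have "map_prod c d p \<noteq> map_prod c d q" if "(p, q) \<in> parcs ?P" for p q
      using that c' d' by (auto simp: cartesian_product_def)
    then have "b (map_prod c d p) \<noteq> b (map_prod c d q)" if "(p, q) \<in> parcs ?P" for p q
      using that inj_onD[OF inj] col P.in_arcsD1 P.in_arcsD2 by metis
    moreover have "b (map_prod c d p) \<in> {1..k * l}" if "p \<in> pverts ?P" for p
      using col[OF that] img by (metis imageI)
    ultimately show "proper_coloring ?P (k * l) (b \<circ> map_prod c d)"
      unfolding proper_coloring_def by fastforce
    show "\<forall>(p, q)\<in>parcs ?P. closed_nbhd ?P p \<noteq> closed_nbhd ?P q
      \<longrightarrow> (b \<circ> map_prod c d) ` closed_nbhd ?P p \<noteq> (b \<circ> map_prod c d) ` closed_nbhd ?P q"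
    proof (intro ballI, clarify)
      fix u v u' v'
      assume pq: "((u, v), (u', v')) \<in> parcs ?P"
        and eq: "(b \<circ> map_prod c d) ` closed_nbhd ?P (u, v)
          = (b \<circ> map_prod c d) ` closed_nbhd ?P (u', v')"
      have "b ` map_prod c d ` closed_nbhd ?P (u, v) = b ` map_prod c d ` closed_nbhd ?P (u', v')"
        using eq by (simp only: image_comp)
      then have "map_prod c d ` closed_nbhd ?P (u, v) = map_prod c d ` closed_nbhd ?P (u', v')"
        using inj_on_image_eq_iff[OF inj nbhd nbhd, OF P.in_arcsD1 P.in_arcsD2, OF pq pq] by (rule iffD1[rotated])
      with sep[OF pq] show False by (rule notE)
    qed
  qed
  then show ?thesis by blast
qed

text \<open>The infimum of the empty set is \<infinity>, and a nonempty set of naturals attains its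
  infimum, so a finite value comes with an optimal coloring.\<close>

lemma chromatic_number_cases:
  obtains "chromatic_number G = \<infinity>"
  | k f where "chromatic_number G = enat k" "proper_coloring G k f"
proof (cases "\<exists>k f. proper_coloring G k f")
  case True
  then have "chromatic_number G = enat (LEAST k. \<exists>f. proper_coloring G k f)"
    unfolding chromatic_number_def by (intro Inf_enat_eq_Least)
  with LeastI_ex[OF True] that(2) show ?thesis by blast
next
  case False
  then show ?thesis
    using that(1) by (simp add: chromatic_number_def top_enat_def)
qed

text \<open>A color for \<open>v\<close> cannot lie in the empty range \<open>{1..0}\<close>. This
  excludes the product 0 * \<infinity>, which is 0 in \<open>enat\<close>, so that an infinite
  factor makes the bound infinite.\<close>

lemma chromatic_number_neq_0:
  assumes "v \<in> pverts G"
  shows "chromatic_number G \<noteq> 0"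
  using assms by (cases G rule: chromatic_number_cases)
    (auto simp: proper_coloring_def zero_enat_def)

theorem theorem4:
  fixes G :: "'a pair_pre_digraph" and H :: "'b pair_pre_digraph"
  assumes "pair_bidirected_digraph G" and "pair_bidirected_digraph H"
    and "Digraph_Component.connected (with_proj G)"
    and "Digraph_Component.connected (with_proj H)"
    and "\<exists>u\<in>pverts G. \<exists>v\<in>pverts G. u \<noteq> v"
    and "\<exists>u\<in>pverts H. \<exists>v\<in>pverts H. u \<noteq> v"
  shows "lid_chromatic_number (cartesian_product G H)
           \<le> chromatic_number G * chromatic_number H"
proof -
  have nz: "chromatic_number G \<noteq> 0" "chromatic_number H \<noteq> 0"
    using assms(5,6) by (auto dest: chromatic_number_neq_0)
  show ?thesis
  proof (cases G rule: chromatic_number_cases)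
    case 1
    then have "chromatic_number G * chromatic_number H = \<infinity>"
      using nz by (simp add: imult_is_infinity)
    then show ?thesis by simp
  next
    case G: (2 k c)
    show ?thesis
    proof (cases H rule: chromatic_number_cases)
      case 1
      then have "chromatic_number G * chromatic_number H = \<infinity>"
        using nz by (simp add: imult_is_infinity)
      then show ?thesis by simp
    next
      case H: (2 l d)
      have "\<exists>f. lid_coloring (cartesian_product G H) (k * l) f"
        using assms G(2) H(2)
        by (intro ex_lid_coloring_cartesian_product connected_ex_neighbor)
      \<comment> \<open>Any single coloring bounds the infimum from above; \<open>k\<close> and
        \<open>l\<close> are the exact chromatic numbers.\<close>
      then have "lid_chromatic_number (cartesian_product G H) \<le> enat (k * l)"
        unfolding lid_chromatic_number_def by (intro Inf_lower) blast
      then show ?thesis by (simp add: G(1) H(1))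
    qed
  qed
qed

end
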